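(* Let $E$ be a real separable Banach space with dual $E'$, and let $\nu,\rho\in ID_{\log}(E)$. Then $$\exp\Big(\int_0^\infty\log\hat\nu(e^{-s}y)\,ds\Big)\cdot\hat\nu(y)=\exp\int_0^\infty\log\hat\rho(e^{-s}y)\,ds\quad\text{for all }y\in E'$$ if and only if $$\hat\nu(y)=\exp\int_0^1\log\hat\rho(sy)\,ds\quad\text{for all }y\in E'.$$
   Context: $ID(E)$ is the set of infinitely divisible Borel probability measures on $E$, and $ID_{\log}(E)=\{\mu\in ID(E):\int_E\log(1+\|x\|)\,\mu(dx)<\infty\}$. For a probability measure $\mu$ on $E$, $\hat\mu(y)=\int_E e^{i\langle y,x\rangle}\mu(dx)$, $y\in E'$. For $\mu\in ID(E)$, $\log\hat\mu$ denotes the Lévy exponent $\Phi$ of $\mu$, where $\hat\mu=e^{\Phi}$ and $$\Phi(y)=i\langle y,a\rangle-\tfrac12\langle Ry,y\rangle+\int_{E\setminus\{0\}}\big[e^{i\langle y,x\rangle}-1-i\langle y,x\rangle 1_{\|x\|\le1}(x)\big]M(dx),$$ with shift $a\in E$, Gaussian covariance operator $R$ and Lévy spectral measure $M$. *)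

theory Defs
  imports "HOL-Probability.Probability"
begin

text \<open>Separability of the Banach space is expressed by the sort
  \<open>{banach, second_countable_topology}\<close>, and the dual space is
  \<open>'a \<Rightarrow>\<^sub>L real\<close>.\<close>

definition borel_prob :: "'a::topological_space measure \<Rightarrow> bool"
  where "borel_prob \<mu> \<longleftrightarrow> prob_space \<mu> \<and> sets \<mu> = sets borel"

text \<open>The library convolution is restricted to ordered Euclidean spaces.\<close>

primrec conv_power :: "nat \<Rightarrow> 'a::{banach, second_countable_topology} measure \<Rightarrow> 'a measure"
  where
    "conv_power 0 \<mu> = return borel 0"
  | "conv_power (Suc n) \<mu> = distr (\<mu> \<Otimes>\<^sub>M conv_power n \<mu>) borel (\<lambda>(x, y). x + y)"

definition ID :: "'a::{banach, second_countable_topology} measure set"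
  where "ID = {\<mu>. borel_prob \<mu> \<and> (\<forall>n\<ge>1. \<exists>\<mu>\<^sub>n. borel_prob \<mu>\<^sub>n \<and> \<mu> = conv_power n \<mu>\<^sub>n)}"

definition ID_log :: "'a::{banach, second_countable_topology} measure set"
  where "ID_log = {\<mu> \<in> ID. integrable \<mu> (\<lambda>x. ln (1 + norm x))}"

definition char_functional ::
    "'a::{banach, second_countable_topology} measure \<Rightarrow> ('a \<Rightarrow>\<^sub>L real) \<Rightarrow> complex"
  where "char_functional \<mu> y = (CLINT x|\<mu>. iexp (blinfun_apply y x))"

text \<open>\<open>R\<close> is the covariance operator of a centred Gaussian measure on the whole Banach space;
  symmetry makes \<open>R\<close> determined by its quadratic form.\<close>

definition gaussian_covariance ::
    "(('a::{banach, second_countable_topology} \<Rightarrow>\<^sub>L real) \<Rightarrow>\<^sub>L 'a) \<Rightarrow> bool"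
  where "gaussian_covariance R \<longleftrightarrow>
    (\<forall>y z. blinfun_apply z (R y) = blinfun_apply y (R z)) \<and>
    (\<exists>\<gamma>. borel_prob \<gamma> \<and>
      (\<forall>y. char_functional \<gamma> y = exp (- complex_of_real (blinfun_apply y (R y)) / 2)))"

definition levy_kernel :: "('a::real_normed_vector \<Rightarrow>\<^sub>L real) \<Rightarrow> 'a \<Rightarrow> complex"
  where "levy_kernel y x =
    iexp (blinfun_apply y x) - 1
      - \<i> * complex_of_real (blinfun_apply y x) * indicator {x. norm x \<le> 1} x"

text \<open>Levy spectral measures are regarded as measures on the whole space without mass at the
  origin.  In a general Banach space the two integrability conditions are necessary but not
  sufficient, so the Poissonian exponent is also required to come from a probability measure.\<close>

definition levy_spectral_measure :: "'a::{banach, second_countable_topology} measure \<Rightarrow> bool"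
  where "levy_spectral_measure M \<longleftrightarrow>
    sets M = sets borel \<and> emeasure M {0} = 0 \<and>
    (\<forall>r>0. emeasure M {x. norm x > r} < \<infinity>) \<and>
    (\<forall>y :: 'a \<Rightarrow>\<^sub>L real. integrable M (\<lambda>x. min 1 ((blinfun_apply y x)\<^sup>2))) \<and>
    (\<exists>\<pi>. borel_prob \<pi> \<and> (\<forall>y. char_functional \<pi> y = exp (CLINT x|M. levy_kernel y x)))"

definition levy_khintchine ::
    "'a::{banach, second_countable_topology} \<Rightarrow> (('a \<Rightarrow>\<^sub>L real) \<Rightarrow>\<^sub>L 'a) \<Rightarrow> 'a measure
      \<Rightarrow> ('a \<Rightarrow>\<^sub>L real) \<Rightarrow> complex"
  where "levy_khintchine a R M y =
    \<i> * complex_of_real (blinfun_apply y a) - complex_of_real (blinfun_apply y (R y)) / 2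
      + (CLINT x|M. levy_kernel y x)"

definition is_levy_exponent ::
    "'a::{banach, second_countable_topology} measure \<Rightarrow> (('a \<Rightarrow>\<^sub>L real) \<Rightarrow> complex) \<Rightarrow> bool"
  where "is_levy_exponent \<mu> \<Phi> \<longleftrightarrow>
    (\<exists>a R M. gaussian_covariance R \<and> levy_spectral_measure M \<and> \<Phi> = levy_khintchine a R M) \<and>
    (\<forall>y. char_functional \<mu> y = exp (\<Phi> y))"

text \<open>\<open>levy_exponent \<mu>\<close> is the function usually written as the logarithm of the characteristic
  functional.  For infinitely divisible \<open>\<mu>\<close> the Levy-Khintchine theorem says that the first
  branch applies.  The second branch only makes the function total: it is the continuous logarithm
  vanishing at the origin, with which a Levy exponent always coincides.\<close>

definition levy_exponent ::
    "'a::{banach, second_countable_topology} measure \<Rightarrow> ('a \<Rightarrow>\<^sub>L real) \<Rightarrow> complex"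
  where "levy_exponent \<mu> =
    (if \<exists>\<Phi>. is_levy_exponent \<mu> \<Phi>
     then THE \<Phi>. is_levy_exponent \<mu> \<Phi>
     else THE \<Phi>. continuous_on UNIV \<Phi> \<and> \<Phi> 0 = 0 \<and> (\<forall>y. char_functional \<mu> y = exp (\<Phi> y)))"

end

theory Submission
  imports Defs
begin

text \<open>
  Let \<open>\<psi>\<close> and \<open>\<phi>\<close> be the Levy exponents of \<open>\<nu>\<close> and \<open>\<rho>\<close>.  Both conditions concern the values on one ray
  at a time, so fix \<open>y\<close> and put \<open>h t = \<psi> (t y)\<close>, \<open>g t = \<phi> (t y)\<close>.  Substituting \<open>u = e\<^sup>-\<^sup>s t\<close>, and without
  the outer exponentials, the conditions at \<open>t y\<close> for all \<open>t > 0\<close> read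
  \<open>\<integral>\<^sub>0\<^sup>t h u / u du + h t = \<integral>\<^sub>0\<^sup>t g u / u du\<close> and \<open>t * h t = \<integral>\<^sub>0\<^sup>t g u du\<close>.  Either one, differentiated, is the
  equation \<open>t * h' t + h t = g t\<close>, and \<open>h 0 = 0\<close> fixes the constant of integration; hence they are
  equivalent (\<open>ray_equation_iff\<close>).  The exponentials lose nothing, because both sides are continuous in
  \<open>t\<close> and tend to \<open>0\<close> at the origin (\<open>continuous_logarithms_eq_at_top\<close>).

  Two facts about a measure in \<open>ID_log\<close> make this argument apply.

  Its Levy exponent is continuous along rays, vanishes at the origin and is a logarithm of the
  characteristic functional (\<open>ray_logarithm_levy_exponent\<close>).  For a Levy-Khintchine exponent this is
  dominated convergence, and for the continuous logarithm it is a lifting argument on the contractible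
  dual space, which needs that characteristic functionals of infinitely divisible measures have no
  zeros (\<open>ID_char_functional_nonzero\<close>).

  The integrals over \<open>[0, \<infinity>)\<close> converge absolutely (\<open>ray_logarithm_integrable\<close>).  Close to the origin the
  logarithm is at most twice the distance from \<open>1\<close> of the characteristic functional at \<open>e\<^sup>-\<^sup>s y\<close>.  This
  distance is at most the \<open>\<mu>\<close>-integral of \<open>min 2 (e\<^sup>-\<^sup>s \<bar>y x\<bar>)\<close>, and integrating over \<open>s\<close> gives at most a
  constant plus \<open>2 * \<integral> ln (1 + \<parallel>x\<parallel>) d\<mu>\<close>.
\<close>

section \<open>Uniqueness of continuous logarithms and the equation on a ray\<close>

text \<open>Two logarithms of the same function differ by an integer multiple of \<open>2 * pi * \<i>\<close>, so their
  difference is a continuous function with discrete range.\<close>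

lemma continuous_logarithms_eq:
  fixes f g :: "'b::topological_space \<Rightarrow> complex"
  assumes S: "connected S" and f: "continuous_on S f" and g: "continuous_on S g"
    and eq: "\<And>x. x \<in> S \<Longrightarrow> exp (f x) = exp (g x)"
    and a: "a \<in> S" "f a = g a" and x: "x \<in> S"
  shows "f x = g x"
proof -
  have "(\<lambda>x. f x - g x) constant_on S"
  proof (rule continuous_discrete_range_constant[OF S])
    show "continuous_on S (\<lambda>x. f x - g x)"
      by (intro continuous_intros f g)
    fix x assume x: "x \<in> S"
    have "2 * pi \<le> norm ((f y - g y) - (f x - g x))"
      if y: "y \<in> S" "f y - g y \<noteq> f x - g x" for y
    proof -
      define z where "z = (f y - g y) - (f x - g x)"
      have "exp z = 1"
        using eq[OF x] eq[OF y(1)] by (simp add: z_def exp_diff)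
      then obtain n :: int where n: "Re z = 0" "Im z = of_int (2 * n) * pi"
        by (auto simp: exp_eq_1)
      with y(2) have "n \<noteq> 0"
        by (auto simp: z_def complex_eq_iff)
      then have "1 \<le> \<bar>real_of_int n\<bar>" by linarith
      then have "2 * pi \<le> \<bar>Im z\<bar>"
        by (simp add: n(2) abs_mult)
      then show ?thesis
        using abs_Im_le_cmod[of z] unfolding z_def by linarith
    qed
    then show "\<exists>e>0. \<forall>y. y \<in> S \<and> f y - g y \<noteq> f x - g x \<longrightarrow>
        e \<le> norm ((f y - g y) - (f x - g x))"
      by (intro exI[of _ "2 * pi"]) auto
  qed
  then show ?thesis
    using a x unfolding constant_on_def by (metis eq_iff_diff_eq_0)
qed

text \<open>Here infinity serves as the base point: where the difference of the two logarithms is smaller than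
  \<open>2 * pi\<close> it must be \<open>0\<close>.\<close>

lemma continuous_logarithms_eq_at_top:
  fixes f g :: "real \<Rightarrow> complex"
  assumes f: "continuous_on UNIV f" "(f \<longlongrightarrow> 0) at_top"
    and g: "continuous_on UNIV g" "(g \<longlongrightarrow> 0) at_top"
    and eq: "\<And>r. exp (f r) = exp (g r)"
  shows "f r = g r"
proof -
  have "((\<lambda>r. f r - g r) \<longlongrightarrow> 0 - 0) at_top"
    by (intro tendsto_intros f g)
  then have "eventually (\<lambda>r. norm (f r - g r) < 1) at_top"
    by (auto simp: tendsto_iff dist_norm dest: spec[of _ 1])
  then obtain a where a: "norm (f a - g a) < 1"
    by (auto simp: eventually_at_top_linorder)
  have "exp (f a - g a) = 1"
    by (simp add: exp_diff eq)
  then obtain n :: int where n: "Re (f a - g a) = 0" "Im (f a - g a) = of_int (2 * n) * pi"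
    by (auto simp: exp_eq_1)
  have "n = 0"
  proof (rule ccontr)
    assume "n \<noteq> 0"
    then have "1 \<le> \<bar>real_of_int n\<bar>" by linarith
    then have "2 * pi \<le> \<bar>Im (f a - g a)\<bar>"
      by (simp only: n(2)) (simp add: abs_mult)
    with a abs_Im_le_cmod[of "f a - g a"] pi_gt3 show False by linarith
  qed
  with n have "f a = g a"
    by (simp add: complex_eq_iff)
  then show ?thesis
    using continuous_logarithms_eq[OF connected_UNIV f(1) g(1)] eq by blast
qed

lemma zero_derivative_vanishing_at_top:
  fixes c :: "real \<Rightarrow> 'b::real_normed_vector"
  assumes "\<And>r. (c has_vector_derivative 0) (at r)" and lim: "(c \<longlongrightarrow> 0) at_top"
  shows "c r = 0"
proof -
  have "\<exists>k. \<forall>x\<in>UNIV. c x = k"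
    using assms(1) by (intro has_derivative_zero_constant) (auto simp: has_vector_derivative_def)
  then obtain k where k: "c = (\<lambda>x. k)" by auto
  with lim have "k = 0"
    by (simp add: tendsto_const_iff)
  with k show ?thesis by simp
qed

text \<open>The exponents \<open>\<integral>\<^sub>0\<^sup>\<infinity> h (e\<^sup>-\<^sup>s t) ds\<close> are handled in the variable \<open>r = - ln t\<close>.  There dilation by
  \<open>t\<close> becomes translation by \<open>r\<close>, and the exponent becomes a tail integral of the fixed function
  \<open>H s = h (e\<^sup>-\<^sup>s)\<close>, which can be differentiated in \<open>r\<close>.\<close>

lemma tail_integral:
  fixes H :: "real \<Rightarrow> complex"
  assumes cont: "continuous_on UNIV H" and int: "set_integrable lborel {0..} H"
  shows tail_integral_has_vector_derivative:
      "((\<lambda>r. CLBINT s:{r..}. H s) has_vector_derivative - H r) (at r)"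
    and tail_integral_tendsto_0: "((\<lambda>r. CLBINT s:{r..}. H s) \<longlongrightarrow> 0) at_top"
    and tail_integral_shift: "(CLBINT s:{0..}. H (s + r)) = (CLBINT s:{r..}. H s)"
proof -
  have compact_int: "set_integrable lborel {a..b} H" for a b
    by (rule borel_integrable_atLeastAtMost') (rule continuous_on_subset[OF cont], simp)
  have int_r: "set_integrable lborel {r..} H" for r
  proof -
    have "set_integrable lborel ({r..0} \<union> {0..}) H"
      by (rule set_integrable_Un[OF compact_int int]) auto
    then show ?thesis
      by (rule set_integrable_subset) auto
  qed
  have meas[measurable]: "H \<in> borel_measurable borel"
    using cont by (rule borel_measurable_continuous_onI)
  \<comment> \<open>Any lower limit below \<open>r\<close> would do: it makes \<open>r\<close> an interior point.\<close>
  define a where "a = r - 1"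
  have split: "(CLBINT s:{x..}. H s) = (CLBINT s:{a..}. H s) - integral {a..x} H"
    if "a \<le> x" for x
  proof -
    have "(CLBINT s:{a..x} \<union> {x<..}. H s) = (CLBINT s:{a..x}. H s) + (CLBINT s:{x<..}. H s)"
      by (rule set_integral_Un[OF _ compact_int set_integrable_subset[OF int_r[of x]]]) auto
    moreover have "{a..x} \<union> {x<..} = {a..}" using that by auto
    moreover have "(CLBINT s:{a..x}. H s) = integral {a..x} H"
      by (rule set_borel_integral_eq_integral(2)[OF compact_int])
    moreover have "(CLBINT s:{x<..}. H s) = (CLBINT s:{x..}. H s)"
    proof (rule set_integral_cong_set)
      show "AE s in lborel. (s \<in> {x..}) = (s \<in> {x<..})"
        using AE_lborel_singleton[of x] by eventually_elim auto
      show "set_borel_measurable lborel {x<..} H" "set_borel_measurable lborel {x..} H"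
        unfolding set_borel_measurable_def by measurable
    qed
    ultimately show ?thesis by simp
  qed
  have "((\<lambda>x. integral {a..x} H) has_vector_derivative H r) (at r within {a..r + 1})"
    by (rule integral_has_vector_derivative)
      (auto simp: a_def intro: continuous_on_subset[OF cont])
  then have "((\<lambda>x. integral {a..x} H) has_vector_derivative H r) (at r)"
    by (subst (asm) at_within_Icc_at) (auto simp: a_def)
  then have "((\<lambda>x. (CLBINT s:{a..}. H s) - integral {a..x} H) has_vector_derivative - H r) (at r)"
    by (auto intro!: derivative_eq_intros)
  then show "((\<lambda>r. CLBINT s:{r..}. H s) has_vector_derivative - H r) (at r)"
  proof (rule has_vector_derivative_transform_within_open[where S = "{a<..}"])
    show "(CLBINT s:{a..}. H s) - integral {a..x} H = (CLBINT s:{x..}. H s)" if "x \<in> {a<..}" for x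
      using split[of x] that by simp
  qed (auto simp: a_def)
  have "((\<lambda>r. CLBINT s:{r..}. H s) \<longlongrightarrow> (\<integral>x. 0 \<partial>(lborel :: real measure))) at_top"
    unfolding set_lebesgue_integral_def
  proof (rule integral_dominated_convergence_at_top[where w = "\<lambda>s. norm (indicator {0..} s *\<^sub>R H s)"])
    show "integrable lborel (\<lambda>s. norm (indicator {0..} s *\<^sub>R H s))"
      using int unfolding set_integrable_def by (rule integrable_norm)
    show "\<forall>\<^sub>F i in at_top. AE x in lborel. norm (indicat_real {i..} x *\<^sub>R H x)
        \<le> norm (indicat_real {0..} x *\<^sub>R H x)"
      using eventually_ge_at_top[of "0::real"]
      by eventually_elim (auto simp: indicator_def)
    have "((\<lambda>i. indicat_real {i..} x *\<^sub>R H x) \<longlongrightarrow> 0) at_top" for x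
    proof (rule tendsto_eventually)
      show "\<forall>\<^sub>F i in at_top. indicat_real {i..} x *\<^sub>R H x = 0"
        using eventually_gt_at_top[of x] by eventually_elim auto
    qed
    then show "AE x in lborel. ((\<lambda>i. indicat_real {i..} x *\<^sub>R H x) \<longlongrightarrow> 0) at_top"
      by simp
  qed auto
  then show "((\<lambda>r. CLBINT s:{r..}. H s) \<longlongrightarrow> 0) at_top" by simp
  have "(CLBINT s:{r..}. H s) = (CLBINT s. indicat_real {r..} (r + s) *\<^sub>R H (r + s))"
    using lborel_integral_real_affine[of 1 "\<lambda>s. indicat_real {r..} s *\<^sub>R H s" r]
    by (simp add: set_lebesgue_integral_def)
  also have "\<dots> = (CLBINT s:{0..}. H (s + r))"
    unfolding set_lebesgue_integral_def
    by (rule Bochner_Integration.integral_cong) (auto simp: indicator_def add.commute)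
  finally show "(CLBINT s:{0..}. H (s + r)) = (CLBINT s:{r..}. H s)" ..
qed

lemma mean_integral_scale:
  fixes g :: "real \<Rightarrow> complex"
  assumes cont: "continuous_on UNIV g" and t: "t > 0"
  shows "t *\<^sub>R (CLBINT s:{0..1}. g (s * t)) = integral {0..t} g"
proof -
  have ci: "set_integrable lborel {a..b} g" for a b
    by (rule borel_integrable_atLeastAtMost') (rule continuous_on_subset[OF cont], simp)
  have "(CLBINT s:{0..t}. g s) = t *\<^sub>R (CLBINT s:{0..1}. g (s * t))"
    unfolding set_lebesgue_integral_def
    using t by (subst lborel_integral_real_affine[where c = t and t = 0])
      (auto intro!: Bochner_Integration.integral_cong simp: indicator_def mult.commute zero_le_mult_iff mult_le_cancel_left1)
  with set_borel_integral_eq_integral(2)[OF ci] show ?thesis by simp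
qed

text \<open>With \<open>H s = h (e\<^sup>-\<^sup>s)\<close>, \<open>K s = g (e\<^sup>-\<^sup>s)\<close>, tail integrals \<open>T H\<close>, \<open>T K\<close> and \<open>Q r\<close> the integral of \<open>g\<close> over
  \<open>[0, e\<^sup>-\<^sup>r]\<close>, the two conditions at \<open>t = e\<^sup>-\<^sup>r\<close> are the exponentials of \<open>T H r + H r = T K r\<close> and of
  \<open>H r = e\<^sup>r Q r\<close>.  All of these functions tend to \<open>0\<close> as \<open>r\<close> grows, so the exponentials can be removed.
  Each of the two resulting equations forces \<open>H' = H - K\<close>.  Since \<open>T H' = - H\<close> and
  \<open>Q' = - e\<^sup>-\<^sup>r K\<close>, the defect in the other equation then has derivative \<open>0\<close>; as it vanishes at infinity,
  it is \<open>0\<close>.\<close>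

lemma ray_equation_iff:
  fixes h g :: "real \<Rightarrow> complex"
  assumes h: "continuous_on UNIV h" "h 0 = 0" "set_integrable lborel {0..} (\<lambda>s. h (exp (- s)))"
    and g: "continuous_on UNIV g" "g 0 = 0" "set_integrable lborel {0..} (\<lambda>s. g (exp (- s)))"
  shows "(\<forall>t>0. exp (CLBINT s:{0..}. h (exp (- s) * t)) * exp (h t)
              = exp (CLBINT s:{0..}. g (exp (- s) * t)))
     \<longleftrightarrow> (\<forall>t>0. exp (h t) = exp (CLBINT s:{0..1}. g (s * t)))"
    (is "?A \<longleftrightarrow> ?B")
proof -
  define H where "H = (\<lambda>s. h (exp (- s)))"
  define K where "K = (\<lambda>s. g (exp (- s)))"
  define T where "T = (\<lambda>F r. CLBINT s:{r::real..}. F s :: complex)"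
  define Q where "Q = (\<lambda>r. integral {0..exp (- r)} g)"
  have contH: "continuous_on UNIV H" and contK: "continuous_on UNIV K"
    unfolding H_def K_def
    by (rule continuous_on_compose2[OF h(1)] continuous_on_compose2[OF g(1)];
        auto intro!: continuous_intros)+
  have exp0: "((\<lambda>s::real. exp (- s)) \<longlongrightarrow> 0) at_top"
    by (rule filterlim_compose[OF exp_at_bot filterlim_uminus_at_bot_at_top])
  have limH: "(H \<longlongrightarrow> 0) at_top"
    unfolding H_def using continuous_on_tendsto_compose[OF h(1) exp0] h(2) by simp
  have TH: "(T H has_vector_derivative - H r) (at r)" "(T H \<longlongrightarrow> 0) at_top"
    "(CLBINT s:{0..}. H (s + r)) = T H r" for r
    using tail_integral[OF contH h(3)[folded H_def]] by (simp_all add: T_def)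
  have TK: "(T K has_vector_derivative - K r) (at r)" "(T K \<longlongrightarrow> 0) at_top"
    "(CLBINT s:{0..}. K (s + r)) = T K r" for r
    using tail_integral[OF contK g(3)[folded K_def]] by (simp_all add: T_def)
  have contT: "continuous_on UNIV (T H)" "continuous_on UNIV (T K)"
    by (auto intro!: continuous_at_imp_continuous_on has_vector_derivative_continuous TH(1) TK(1))
  have TH0: "(CLBINT s:{0..}. h (exp (- s) * exp (- r))) = T H r" for r
    using TH(3)[of r] by (simp add: T_def H_def exp_add[symmetric] add.commute)
  have TK0: "(CLBINT s:{0..}. g (exp (- s) * exp (- r))) = T K r" for r
    using TK(3)[of r] by (simp add: T_def K_def exp_add[symmetric] add.commute)
  have P0: "(CLBINT s:{0..1}. g (s * exp (- r))) = exp r *\<^sub>R Q r" for r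
    by (simp add: Q_def exp_minus flip: mean_integral_scale[OF g(1)])
  have pos: "(\<forall>t>0. X t) \<longleftrightarrow> (\<forall>r. X (exp (- r)))" for X :: "real \<Rightarrow> bool"
    by (metis exp_gt_zero exp_ln minus_minus)
  have derQ: "(Q has_vector_derivative - (exp (- r) *\<^sub>R K r)) (at r)" for r
  proof -
    have "((\<lambda>t. integral {0..t} g) has_vector_derivative g (exp (- r)))
        (at (exp (- r)) within {0..exp (- r) + 1})"
      by (rule integral_has_vector_derivative) (auto intro: continuous_on_subset[OF g(1)])
    then have 1: "((\<lambda>t. integral {0..t} g) has_vector_derivative g (exp (- r))) (at (exp (- r)))"
      by (subst (asm) at_within_Icc_at) auto
    have 2: "((\<lambda>r. exp (- r)) has_vector_derivative - exp (- r)) (at r)"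
      by (auto intro!: derivative_eq_intros simp: has_real_derivative_iff_has_vector_derivative[symmetric])
    show ?thesis
      using vector_diff_chain_at[OF 2 1] by (simp add: Q_def K_def o_def)
  qed
  have expP: "((\<lambda>r. exp r *\<^sub>R Q r) has_vector_derivative exp r *\<^sub>R Q r - K r) (at r)" for r
  proof -
    have "((\<lambda>r. exp r *\<^sub>R Q r) has_vector_derivative
        exp r *\<^sub>R (- (exp (- r) *\<^sub>R K r)) + exp r *\<^sub>R Q r) (at r)"
      by (rule has_vector_derivative_scaleR[OF DERIV_exp derQ])
    then show ?thesis
      by (simp add: exp_minus field_simps)
  qed
  have limQ: "(Q \<longlongrightarrow> 0) at_top"
  proof -
    have "continuous_on {0..1} (\<lambda>t. integral {0..t} g)"
      by (rule indefinite_integral_continuous_1)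
        (auto intro!: integrable_continuous_real continuous_on_subset[OF g(1)])
    then have "((\<lambda>r. integral {0..exp (- r)} g) \<longlongrightarrow> integral {0..0} g) at_top"
      by (rule continuous_on_tendsto_compose[OF _ exp0])
        (auto intro!: eventually_mono[OF eventually_ge_at_top[of "0::real"]])
    then show ?thesis by (simp add: Q_def)
  qed
  have limP: "((\<lambda>r. exp r *\<^sub>R Q r) \<longlongrightarrow> 0) at_top"
  proof -
    \<comment> \<open>\<open>e\<^sup>r Q r\<close> is the mean of \<open>g\<close> over \<open>[0, e\<^sup>-\<^sup>r]\<close>, so it tends to the one-sided derivative \<open>g 0 = 0\<close>
      of the indefinite integral.\<close>
    have "((\<lambda>t. integral {0..t} g) has_vector_derivative g 0) (at 0 within {0..1})"
      by (rule integral_has_vector_derivative) (auto intro: continuous_on_subset[OF g(1)])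
    then have "((\<lambda>t. (1 / norm t) *\<^sub>R integral {0..t} g) \<longlongrightarrow> 0) (at 0 within {0..1})"
      by (simp add: has_vector_derivative_def has_derivative_within g(2))
    moreover have "filterlim (\<lambda>r::real. exp (- r)) (at 0 within {0..1}) at_top"
      using exp0 by (auto simp: filterlim_at intro!: eventually_mono[OF eventually_ge_at_top[of "0::real"]])
    ultimately have "((\<lambda>r::real. (1 / norm (exp (- r))) *\<^sub>R integral {0..exp (- r)} g) \<longlongrightarrow> 0) at_top"
      by (rule filterlim_compose)
    moreover have "1 / norm (exp (- r)) = exp r" for r :: real
      using exp_minus_inverse[of r] by (simp add: divide_eq_eq)
    ultimately show ?thesis
      unfolding Q_def by (simp only:)
  qed
  have A: "?A \<longleftrightarrow> (\<forall>r. T H r + H r = T K r)"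
  proof -
    have "?A \<longleftrightarrow> (\<forall>r. exp (T H r + H r) = exp (T K r))"
      unfolding pos[of "\<lambda>t. exp (CLBINT s:{0..}. h (exp (- s) * t)) * exp (h t)
              = exp (CLBINT s:{0..}. g (exp (- s) * t))"] TH0 TK0
      by (simp add: H_def exp_add)
    also have "\<dots> \<longleftrightarrow> (\<forall>r. T H r + H r = T K r)"
    proof
      assume eq: "\<forall>r. exp (T H r + H r) = exp (T K r)"
      have "((\<lambda>r. T H r + H r) \<longlongrightarrow> 0) at_top"
        using tendsto_add[OF TH(2) limH] by simp
      then show "\<forall>r. T H r + H r = T K r"
        using continuous_logarithms_eq_at_top[OF continuous_on_add[OF contT(1) contH] _ contT(2) TK(2)] eq
        by blast
    qed simp
    finally show ?thesis .
  qed
  have B: "?B \<longleftrightarrow> (\<forall>r. H r = exp r *\<^sub>R Q r)"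
  proof -
    have "?B \<longleftrightarrow> (\<forall>r. exp (H r) = exp (exp r *\<^sub>R Q r))"
      unfolding pos[of "\<lambda>t. exp (h t) = exp (CLBINT s:{0..1}. g (s * t))"] P0
      by (simp add: H_def)
    also have "\<dots> \<longleftrightarrow> (\<forall>r. H r = exp r *\<^sub>R Q r)"
    proof
      assume eq: "\<forall>r. exp (H r) = exp (exp r *\<^sub>R Q r)"
      have "continuous_on UNIV (\<lambda>r. exp r *\<^sub>R Q r)"
        using expP
        by (auto intro!: continuous_at_imp_continuous_on has_vector_derivative_continuous)
      then show "\<forall>r. H r = exp r *\<^sub>R Q r"
        using continuous_logarithms_eq_at_top[OF contH limH _ limP] eq by blast
    qed simp
    finally show ?thesis .
  qed
  have AB: "H r = exp r *\<^sub>R Q r" if "\<forall>r. T H r + H r = T K r" for r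
  proof -
    have H: "H = (\<lambda>r. T K r - T H r)"
      using that by (auto simp: fun_eq_iff algebra_simps)
    have derH: "(H has_vector_derivative H r - K r) (at r)" for r
      using has_vector_derivative_diff[OF TK(1) TH(1), of r] H by simp
    have "((\<lambda>r. exp (- r) *\<^sub>R H r - Q r) has_vector_derivative 0) (at r)" for r
    proof -
      have 2: "((\<lambda>r. exp (- r)) has_real_derivative - exp (- r)) (at r)"
        by (auto intro!: derivative_eq_intros)
      have "((\<lambda>r. exp (- r) *\<^sub>R H r - Q r) has_vector_derivative
          (exp (- r) *\<^sub>R (H r - K r) + (- exp (- r)) *\<^sub>R H r) - - (exp (- r) *\<^sub>R K r)) (at r)"
        by (rule has_vector_derivative_diff[OF has_vector_derivative_scaleR[OF 2 derH] derQ])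
      then show ?thesis
        by (simp add: algebra_simps)
    qed
    moreover have "((\<lambda>r. exp (- r) *\<^sub>R H r - Q r) \<longlongrightarrow> 0) at_top"
      using tendsto_diff[OF tendsto_scaleR[OF exp0 limH] limQ] by simp
    ultimately have "exp (- r) *\<^sub>R H r - Q r = 0"
      by (rule zero_derivative_vanishing_at_top)
    then have "Q r = exp (- r) *\<^sub>R H r" by simp
    then show ?thesis
      by (simp add: exp_minus)
  qed
  have BA: "T H r + H r = T K r" if "\<forall>r. H r = exp r *\<^sub>R Q r" for r
  proof -
    have derH: "(H has_vector_derivative H r - K r) (at r)" for r
      using expP[of r] that by (metis (no_types, lifting) ext)
    have "((\<lambda>r. T H r + H r - T K r) has_vector_derivative 0) (at r)" for r
      using has_vector_derivative_diff[OF has_vector_derivative_add[OF TH(1) derH] TK(1), of r] by simp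
    moreover have "((\<lambda>r. T H r + H r - T K r) \<longlongrightarrow> 0) at_top"
      using tendsto_diff[OF tendsto_add[OF TH(2) limH] TK(2)] by simp
    ultimately have "T H r + H r - T K r = 0"
      by (rule zero_derivative_vanishing_at_top)
    then show ?thesis by simp
  qed
  show ?thesis
    unfolding A B using AB BA by blast
qed

section \<open>Characteristic functionals of infinitely divisible measures\<close>

lemma borel_prob_integrable_bounded:
  fixes f :: "'a::{banach, second_countable_topology} \<Rightarrow> 'b::{banach, second_countable_topology}"
  assumes \<mu>: "borel_prob \<mu>" and f: "f \<in> borel_measurable borel" and "\<And>x. norm (f x) \<le> B"
  shows "integrable \<mu> f"
proof -
  interpret prob_space \<mu> using \<mu> by (simp add: borel_prob_def)
  have "sets \<mu> = sets borel" using \<mu> by (simp add: borel_prob_def)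
  then show ?thesis
    using f assms(3) by (intro integrable_const_bound[where B = B]) (simp_all cong: measurable_cong_sets)
qed

lemma borel_measurable_blinfun_apply [measurable]:
  "blinfun_apply (y :: 'a::{banach, second_countable_topology} \<Rightarrow>\<^sub>L real) \<in> borel_measurable borel"
  by (intro borel_measurable_continuous_onI continuous_intros)

lemma integrable_iexp_blinfun:
  fixes \<mu> :: "'a::{banach, second_countable_topology} measure"
  assumes "borel_prob \<mu>"
  shows "integrable \<mu> (\<lambda>x. iexp (blinfun_apply y x))"
  using assms by (rule borel_prob_integrable_bounded[where B = 1]) simp_all

lemma char_functional_0:
  assumes "borel_prob \<mu>"
  shows "char_functional \<mu> 0 = 1"
proof -
  interpret prob_space \<mu> using assms by (simp add: borel_prob_def)
  show ?thesis by (simp add: char_functional_def prob_space)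
qed

lemma continuous_on_char_functional:
  assumes \<mu>: "borel_prob \<mu>"
  shows "continuous_on UNIV (char_functional \<mu>)"
proof (rule continuous_on_sequentiallyI)
  interpret prob_space \<mu> using \<mu> by (simp add: borel_prob_def)
  have sets [measurable_cong]: "sets \<mu> = sets borel" using \<mu> by (simp add: borel_prob_def)
  fix u :: "nat \<Rightarrow> 'a \<Rightarrow>\<^sub>L real" and y assume u: "u \<longlonglongrightarrow> y"
  show "(\<lambda>n. char_functional \<mu> (u n)) \<longlonglongrightarrow> char_functional \<mu> y"
    unfolding char_functional_def
  proof (rule integral_dominated_convergence[where w = "\<lambda>_. 1"])
    show "AE x in \<mu>. (\<lambda>i. iexp (blinfun_apply (u i) x)) \<longlonglongrightarrow> iexp (blinfun_apply y x)"
      by (intro AE_I2 tendsto_intros u)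
  qed auto
qed

lemma borel_prob_conv_power:
  assumes \<mu>: "borel_prob \<mu>"
  shows "borel_prob (conv_power n \<mu>)"
proof (induction n)
  case 0
  show ?case by (simp add: borel_prob_def prob_space_return)
next
  case (Suc n)
  interpret a: prob_space \<mu> using \<mu> by (simp add: borel_prob_def)
  interpret b: prob_space "conv_power n \<mu>" using Suc by (simp add: borel_prob_def)
  interpret pair_prob_space \<mu> "conv_power n \<mu>" ..
  have [measurable_cong]: "sets \<mu> = sets borel" "sets (conv_power n \<mu>) = sets borel"
    using \<mu> Suc by (simp_all add: borel_prob_def)
  show ?case
    by (simp add: borel_prob_def) (rule prob_space_distr, measurable)
qed

lemma char_functional_conv_power:
  assumes \<mu>: "borel_prob \<mu>"
  shows "char_functional (conv_power n \<mu>) y = char_functional \<mu> y ^ n"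
proof (induction n)
  case 0
  show ?case by (simp add: char_functional_def integral_return)
next
  case (Suc n)
  let ?\<kappa> = "conv_power n \<mu>"
  have \<kappa>: "borel_prob ?\<kappa>" by (rule borel_prob_conv_power[OF \<mu>])
  interpret a: prob_space \<mu> using \<mu> by (simp add: borel_prob_def)
  interpret b: prob_space ?\<kappa> using \<kappa> by (simp add: borel_prob_def)
  interpret pair_prob_space \<mu> ?\<kappa> ..
  have [measurable_cong]: "sets \<mu> = sets borel" "sets ?\<kappa> = sets borel"
    using \<mu> \<kappa> by (simp_all add: borel_prob_def)
  have "char_functional (conv_power (Suc n) \<mu>) y
      = (\<integral>p. iexp (blinfun_apply y (case p of (x, z) \<Rightarrow> x + z)) \<partial>(\<mu> \<Otimes>\<^sub>M ?\<kappa>))"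
    unfolding char_functional_def conv_power.simps by (rule integral_distr) measurable
  also have "\<dots> = (\<integral>(x, z). iexp (blinfun_apply y x) * iexp (blinfun_apply y z) \<partial>(\<mu> \<Otimes>\<^sub>M ?\<kappa>))"
    by (rule Bochner_Integration.integral_cong)
      (auto simp: blinfun.add_right exp_add ring_distribs)
  also have "\<dots> = (\<integral>x. (\<integral>z. iexp (blinfun_apply y x) * iexp (blinfun_apply y z) \<partial>?\<kappa>) \<partial>\<mu>)"
  proof (subst integral_fst'[symmetric], goal_cases)
    case 1
    show ?case
      by (rule P.integrable_const_bound[where B = 1]) (auto simp: norm_mult)
  qed simp
  also have "\<dots> = char_functional \<mu> y * char_functional ?\<kappa> y"
    by (simp add: char_functional_def)
  finally show ?case by (simp add: Suc)
qed

text \<open>This is \<open>1 - cos (2 * t) \<le> 4 * (1 - cos t)\<close>, integrated.  Rotating by the argument \<open>a\<close> of the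
  characteristic functional at \<open>y\<close>, that is, taking \<open>t = y x - a\<close>, turns the integral of \<open>cos t\<close> into
  the modulus.\<close>

lemma norm_char_functional_double:
  assumes \<mu>: "borel_prob \<mu>"
  shows "1 - norm (char_functional \<mu> (2 *\<^sub>R y)) \<le> 4 * (1 - norm (char_functional \<mu> y))"
proof -
  interpret prob_space \<mu> using \<mu> by (simp add: borel_prob_def)
  define a where "a = Arg (char_functional \<mu> y)"
  have rot: "integrable \<mu> (\<lambda>x. cos (c * blinfun_apply y x - b))"
    "(\<integral>x. cos (c * blinfun_apply y x - b) \<partial>\<mu>) = Re (iexp (- b) * char_functional \<mu> (c *\<^sub>R y))"
    for b c :: real
  proof -
    have i: "integrable \<mu> (\<lambda>x. iexp (- b) * iexp (blinfun_apply (c *\<^sub>R y) x))"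
      by (intro integrable_mult_right integrable_iexp_blinfun \<mu>)
    have eq: "cos (c * blinfun_apply y x - b) = Re (iexp (- b) * iexp (blinfun_apply (c *\<^sub>R y) x))" for x
    proof -
      have "iexp (- b) * iexp (blinfun_apply (c *\<^sub>R y) x) = iexp (c * blinfun_apply y x - b)"
        by (simp add: exp_add[symmetric] blinfun.scaleR_left algebra_simps)
      then show ?thesis by (simp only: cis_conv_exp[symmetric] cis.simps)
    qed
    show "integrable \<mu> (\<lambda>x. cos (c * blinfun_apply y x - b))"
      unfolding eq by (rule integrable_Re[OF i])
    show "(\<integral>x. cos (c * blinfun_apply y x - b) \<partial>\<mu>) = Re (iexp (- b) * char_functional \<mu> (c *\<^sub>R y))"
      unfolding eq integral_Re[OF i] char_functional_def by simp
  qed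
  have pt: "1 - cos (2 * blinfun_apply y x - 2 * a) \<le> 4 * (1 - cos (1 * blinfun_apply y x - a))" for x
  proof -
    define t where "t = blinfun_apply y x - a"
    have "1 - cos (2 * t) = 2 * (1 - cos t) * (1 + cos t)"
      unfolding cos_double_cos by (simp add: power2_eq_square algebra_simps)
    also have "\<dots> \<le> 2 * (1 - cos t) * 2"
      by (rule mult_left_mono) auto
    finally show ?thesis by (simp add: t_def right_diff_distrib)
  qed
  have "(\<integral>x. 1 - cos (2 * blinfun_apply y x - 2 * a) \<partial>\<mu>)
      \<le> (\<integral>x. 4 * (1 - cos (1 * blinfun_apply y x - a)) \<partial>\<mu>)"
    by (intro integral_mono Bochner_Integration.integrable_diff integrable_mult_right rot integrable_const pt)
  then have "1 - Re (iexp (- (2 * a)) * char_functional \<mu> (2 *\<^sub>R y))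
      \<le> 4 * (1 - Re (iexp (- a) * char_functional \<mu> y))"
    using rot(1)[of 2 "2 * a"] rot(1)[of 1 a] rot(2)[of 2 "2 * a"] rot(2)[of 1 a]
    by (simp add: prob_space)
  moreover have "Re (iexp (- a) * char_functional \<mu> y) = norm (char_functional \<mu> y)"
  proof -
    have "char_functional \<mu> y = norm (char_functional \<mu> y) * iexp a"
      using Arg_eq[of "char_functional \<mu> y"] by (cases "char_functional \<mu> y = 0") (auto simp: a_def)
    then have "iexp (- a) * char_functional \<mu> y = norm (char_functional \<mu> y) * (iexp (- a) * iexp a)"
      by simp
    then have "iexp (- a) * char_functional \<mu> y = norm (char_functional \<mu> y)"
      by (simp add: exp_add[symmetric])
    then show ?thesis by (simp only: Re_complex_of_real)
  qed
  moreover have "Re (iexp (- (2 * a)) * char_functional \<mu> (2 *\<^sub>R y)) \<le> norm (char_functional \<mu> (2 *\<^sub>R y))"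
    using complex_Re_le_cmod[of "iexp (- (2 * a)) * char_functional \<mu> (2 *\<^sub>R y)"] by (simp add: norm_mult)
  ultimately show ?thesis by argo
qed

text \<open>Non-vanishing passes from \<open>z\<close> to \<open>2 z\<close>.  The modulus at \<open>z\<close> of the characteristic functional of an
  \<open>n\<close>-th convolution root is the \<open>n\<close>-th root of a positive number, hence close to \<open>1\<close> for large \<open>n\<close>;
  by the doubling inequality it is then positive at \<open>2 z\<close>.  Near \<open>0\<close> the functional is close to \<open>1\<close>,
  and repeated doubling reaches every \<open>y\<close>.\<close>

lemma ID_char_functional_nonzero:
  assumes "\<mu> \<in> ID"
  shows "char_functional \<mu> y \<noteq> 0"
proof -
  have \<mu>: "borel_prob \<mu>" using assms by (simp add: ID_def)
  have double: "char_functional \<mu> (2 *\<^sub>R z) \<noteq> 0" if z: "char_functional \<mu> z \<noteq> 0" for z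
  proof -
    \<comment> \<open>Above modulus \<open>3 / 4\<close> the doubling inequality gives a positive modulus at \<open>2 z\<close>.\<close>
    have "(\<lambda>n. (3 / 4 :: real) ^ n) \<longlonglongrightarrow> 0"
      by (rule LIMSEQ_realpow_zero) auto
    then have "eventually (\<lambda>n. (3 / 4 :: real) ^ n < norm (char_functional \<mu> z)) sequentially"
      by (rule order_tendstoD) (use z in simp)
    then have "eventually (\<lambda>n. (3 / 4 :: real) ^ n < norm (char_functional \<mu> z) \<and> n \<ge> 1) sequentially"
      by (intro eventually_conj eventually_ge_at_top)
    then obtain n :: nat where n: "(3 / 4 :: real) ^ n < norm (char_functional \<mu> z)" "n \<ge> 1"
      by (auto simp: eventually_sequentially)
    obtain \<kappa> where \<kappa>: "borel_prob \<kappa>" "\<mu> = conv_power n \<kappa>"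
      using assms n(2) by (auto simp: ID_def)
    have "(3 / 4 :: real) ^ n < norm (char_functional \<kappa> z) ^ n"
      using n(1) by (simp add: \<kappa> char_functional_conv_power norm_power)
    then have "3 / 4 < norm (char_functional \<kappa> z)"
      by (rule power_less_imp_less_base) simp
    then have "norm (char_functional \<kappa> (2 *\<^sub>R z)) > 0"
      using norm_char_functional_double[OF \<kappa>(1), of z] by argo
    then show ?thesis
      by (simp add: \<kappa> char_functional_conv_power)
  qed
  have "(\<lambda>n. (1 / 2 :: real) ^ n *\<^sub>R y) \<longlonglongrightarrow> 0 *\<^sub>R y"
    by (intro tendsto_intros LIMSEQ_realpow_zero) auto
  then have "(\<lambda>n. char_functional \<mu> ((1 / 2 :: real) ^ n *\<^sub>R y)) \<longlonglongrightarrow> char_functional \<mu> 0"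
    by (intro continuous_on_tendsto_compose[OF continuous_on_char_functional[OF \<mu>]]) auto
  then have "eventually (\<lambda>n. char_functional \<mu> ((1 / 2 :: real) ^ n *\<^sub>R y) \<noteq> 0) sequentially"
    by (rule tendsto_imp_eventually_ne) (simp add: char_functional_0[OF \<mu>])
  then obtain n where n: "char_functional \<mu> ((1 / 2 :: real) ^ n *\<^sub>R y) \<noteq> 0"
    by (auto simp: eventually_sequentially)
  have "char_functional \<mu> (2 ^ k *\<^sub>R (1 / 2 :: real) ^ n *\<^sub>R y) \<noteq> 0" for k
    by (induction k) (use n double in \<open>auto simp flip: scaleR_scaleR\<close>)
  from this[of n] show ?thesis
    by (simp add: power_one_over)
qed

section \<open>Levy exponents as logarithms along rays\<close>

text \<open>Continuity is required only along rays.  That is enough for uniqueness, and for a Levy exponent it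
  follows by dominated convergence from integrability of \<open>min 1 (y x)\<^sup>2\<close> for each single \<open>y\<close>; for
  a functional moving in other directions this gives no common dominating function.\<close>

definition ray_logarithm ::
    "'a::{banach, second_countable_topology} measure \<Rightarrow> (('a \<Rightarrow>\<^sub>L real) \<Rightarrow> complex) \<Rightarrow> bool"
  where "ray_logarithm \<mu> \<Phi> \<longleftrightarrow>
    \<Phi> 0 = 0 \<and> (\<forall>y. continuous_on UNIV (\<lambda>t. \<Phi> (t *\<^sub>R y))) \<and>
    (\<forall>y. char_functional \<mu> y = exp (\<Phi> y))"

lemma ray_logarithm_unique:
  assumes "ray_logarithm \<mu> \<Phi>" "ray_logarithm \<mu> \<Psi>"
  shows "\<Phi> = \<Psi>"
proof
  fix y
  have "\<Phi> (1 *\<^sub>R y) = \<Psi> (1 *\<^sub>R y)"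
    by (rule continuous_logarithms_eq[OF connected_UNIV, where f = "\<lambda>t. \<Phi> (t *\<^sub>R y)" and a = 0])
      (use assms in \<open>auto simp: ray_logarithm_def\<close>)
  then show "\<Phi> y = \<Psi> y" by simp
qed

lemma continuous_logarithm_imp_ray_logarithm:
  assumes "continuous_on UNIV \<Phi>" "\<Phi> 0 = 0" "\<And>y. char_functional \<mu> y = exp (\<Phi> y)"
  shows "ray_logarithm \<mu> \<Phi>"
  unfolding ray_logarithm_def using assms
  by (auto intro!: continuous_on_compose2[OF assms(1)] continuous_intros)

text \<open>The dominating function for dilations of a fixed \<open>y\<close>: quadratic Taylor remainder inside the unit
  ball, trivial bound outside.  The factor \<open>1 + \<parallel>y\<parallel>\<^sup>2\<close> pays for replacing \<open>(y x)\<^sup>2\<close>, which is at most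
  \<open>\<parallel>y\<parallel>\<^sup>2\<close> in the unit ball, by its minimum with \<open>1\<close>.\<close>

lemma norm_levy_kernel_le:
  assumes "\<bar>t\<bar> \<le> B"
  shows "norm (levy_kernel (t *\<^sub>R y) x)
    \<le> B\<^sup>2 * (1 + (norm y)\<^sup>2) * min 1 ((blinfun_apply y x)\<^sup>2) + 2 * indicator {x. 1 < norm x} x"
proof (cases "norm x \<le> 1")
  case True
  define a where "a = blinfun_apply y x"
  have a: "\<bar>a\<bar> \<le> norm y"
    using norm_blinfun[of y x] True mult_left_mono[OF True norm_ge_zero[of y]]
    by (simp add: a_def)
  have "norm (levy_kernel (t *\<^sub>R y) x) = norm (iexp (t * a) - (\<Sum>k\<le>1. (\<i> * (t * a)) ^ k / fact k))"
    using True by (simp add: levy_kernel_def a_def blinfun.scaleR_left diff_diff_eq)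
  also have "\<dots> \<le> \<bar>t * a\<bar> ^ Suc 1 / fact (Suc 1)"
    by (rule iexp_approx1)
  also have "\<dots> = t\<^sup>2 * a\<^sup>2 / 2"
  proof -
    have "\<bar>t * a\<bar> ^ Suc 1 = t\<^sup>2 * a\<^sup>2"
      by (simp only: Suc_1 power2_abs power_mult_distrib)
    then show ?thesis by simp
  qed
  also have "\<dots> \<le> t\<^sup>2 * a\<^sup>2" by simp
  also have "\<dots> \<le> B\<^sup>2 * ((1 + (norm y)\<^sup>2) * min 1 (a\<^sup>2))"
  proof (rule mult_mono)
    show "t\<^sup>2 \<le> B\<^sup>2" using assms by (rule power2_le_iff_abs_le[THEN iffD2, rotated]) (use assms in linarith)
    have "a\<^sup>2 \<le> (norm y)\<^sup>2" using a by (simp add: abs_le_square_iff[symmetric])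
    then show "a\<^sup>2 \<le> (1 + (norm y)\<^sup>2) * min 1 (a\<^sup>2)"
      by (auto simp: min_def algebra_simps)
  qed auto
  finally show ?thesis
    using True by (simp add: a_def mult.assoc)
next
  case False
  have "norm (levy_kernel (t *\<^sub>R y) x) = norm (iexp (blinfun_apply (t *\<^sub>R y) x) - 1)"
    using False by (simp add: levy_kernel_def)
  also have "\<dots> \<le> 2"
    using norm_triangle_ineq4[of "iexp (blinfun_apply (t *\<^sub>R y) x)" 1] by simp
  also have "2 \<le> B\<^sup>2 * (1 + (norm y)\<^sup>2) * min 1 ((blinfun_apply y x)\<^sup>2) + 2 * indicator {x. 1 < norm x} x"
    using False by (simp add: indicator_def)
  finally show ?thesis .
qed

lemma continuous_on_levy_integral_ray:
  fixes M :: "'a::{banach, second_countable_topology} measure"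
  assumes M: "levy_spectral_measure M"
  shows "continuous_on UNIV (\<lambda>t. CLINT x|M. levy_kernel (t *\<^sub>R y) x)"
proof (rule continuous_on_sequentiallyI)
  have [measurable_cong]: "sets M = sets borel"
    using M by (simp add: levy_spectral_measure_def)
  have meas: "levy_kernel z \<in> borel_measurable borel" for z :: "'a \<Rightarrow>\<^sub>L real"
    unfolding levy_kernel_def[abs_def] by measurable
  fix u :: "nat \<Rightarrow> real" and t assume u: "u \<longlonglongrightarrow> t"
  then obtain B where B: "\<And>n. \<bar>u n\<bar> \<le> B"
    using Bseq_def[of u] convergent_imp_Bseq[of u] by (auto simp: convergent_def)
  let ?w = "\<lambda>x. B\<^sup>2 * (1 + (norm y)\<^sup>2) * min 1 ((blinfun_apply y x)\<^sup>2) + 2 * indicator {x. 1 < norm x} x"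
  show "(\<lambda>n. CLINT x|M. levy_kernel (u n *\<^sub>R y) x) \<longlonglongrightarrow> (CLINT x|M. levy_kernel (t *\<^sub>R y) x)"
  proof (rule integral_dominated_convergence[where w = ?w])
    have "{x::'a. 1 < norm x} \<in> sets M" by measurable
    moreover have "emeasure M {x. 1 < norm x} < \<infinity>"
      using M by (simp add: levy_spectral_measure_def)
    ultimately have "integrable M (indicat_real {x. 1 < norm x})"
      by (rule integrable_real_indicator)
    then show "integrable M ?w"
      using M by (intro Bochner_Integration.integrable_add integrable_mult_right)
        (auto simp: levy_spectral_measure_def)
    show "AE x in M. (\<lambda>i. levy_kernel (u i *\<^sub>R y) x) \<longlonglongrightarrow> levy_kernel (t *\<^sub>R y) x"
      unfolding levy_kernel_def by (intro AE_I2 tendsto_intros u)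
    show "AE x in M. norm (levy_kernel (u i *\<^sub>R y) x) \<le> ?w x" for i
      using norm_levy_kernel_le[OF B] by auto
  qed (use meas in measurable)
qed

lemma levy_exponent_imp_ray_logarithm:
  assumes "is_levy_exponent \<mu> \<Phi>"
  shows "ray_logarithm \<mu> \<Phi>"
proof -
  obtain a R M where M: "levy_spectral_measure M" and \<Phi>: "\<Phi> = levy_khintchine a R M"
    using assms by (auto simp: is_levy_exponent_def)
  have "continuous_on UNIV (\<lambda>t. \<Phi> (t *\<^sub>R y))" for y
    unfolding \<Phi> levy_khintchine_def
    by (intro continuous_intros continuous_on_levy_integral_ray[OF M]) auto
  moreover have "\<Phi> 0 = 0"
    by (simp add: \<Phi> levy_khintchine_def levy_kernel_def)
  ultimately show ?thesis
    using assms by (simp add: ray_logarithm_def is_levy_exponent_def)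
qed

text \<open>Where a Levy-Khintchine representation exists, its exponent is the ray logarithm.  Otherwise the
  dual space, being contractible, carries a continuous logarithm of the non-vanishing characteristic
  functional.  In both cases uniqueness of ray logarithms identifies the chosen function.\<close>

lemma ray_logarithm_levy_exponent:
  assumes "\<mu> \<in> ID"
  shows "ray_logarithm \<mu> (levy_exponent \<mu>)"
proof (cases "\<exists>\<Phi>. is_levy_exponent \<mu> \<Phi>")
  case True
  then obtain \<Phi> where \<Phi>: "is_levy_exponent \<mu> \<Phi>" by blast
  have "levy_exponent \<mu> = (THE \<Phi>. is_levy_exponent \<mu> \<Phi>)"
    using True by (simp add: levy_exponent_def)
  also have "\<dots> = \<Phi>"
    using \<Phi> levy_exponent_imp_ray_logarithm ray_logarithm_unique by blast
  finally show ?thesis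
    using levy_exponent_imp_ray_logarithm[OF \<Phi>] by simp
next
  case False
  have \<mu>: "borel_prob \<mu>" using assms by (simp add: ID_def)
  obtain g where g: "continuous_on UNIV g" "\<And>y. char_functional \<mu> y = exp (g y)"
    by (rule continuous_logarithm_on_contractible[OF continuous_on_char_functional[OF \<mu>]
        convex_imp_contractible[OF convex_UNIV] ID_char_functional_nonzero[OF assms]])
      (rule that, simp_all)
  define \<Phi> where "\<Phi> = (\<lambda>y. g y - g 0)"
  have "exp (g 0) = 1"
    using g(2)[of 0] char_functional_0[OF \<mu>] by simp
  then have \<Phi>: "continuous_on UNIV \<Phi> \<and> \<Phi> 0 = 0 \<and> (\<forall>y. char_functional \<mu> y = exp (\<Phi> y))"
    by (auto simp: \<Phi>_def g(2) exp_diff intro!: continuous_intros g(1))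
  have "levy_exponent \<mu> = (THE \<Phi>. continuous_on UNIV \<Phi> \<and> \<Phi> 0 = 0 \<and> (\<forall>y. char_functional \<mu> y = exp (\<Phi> y)))"
    using False by (simp add: levy_exponent_def)
  also have "\<dots> = \<Phi>"
    using \<Phi> continuous_logarithm_imp_ray_logarithm ray_logarithm_unique
    by (intro the_equality) blast+
  finally show ?thesis
    using \<Phi> continuous_logarithm_imp_ray_logarithm by blast
qed

section \<open>Integrability from the logarithmic moment\<close>

text \<open>Split at \<open>L = ln (1 + c)\<close>: before \<open>L\<close> the integrand is at most \<open>2\<close>, and after \<open>L\<close> it is at most
  \<open>(1 + c) e\<^sup>-\<^sup>s\<close>, which has integral \<open>1\<close>.  This is the source of the logarithmic moment.\<close>

lemma nn_integral_truncated_exp_le: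
  assumes c: "c \<ge> 0"
  shows "(\<integral>\<^sup>+s. ennreal (min 2 (exp (- s) * c)) * indicator {0..} s \<partial>lborel) \<le> ennreal (2 * ln (1 + c) + 1)"
proof -
  define L where "L = ln (1 + c)"
  have L: "L \<ge> 0" "exp (- L) * (1 + c) = 1" using c by (auto simp: L_def exp_minus)
  have "(\<integral>\<^sup>+s. ennreal (min 2 (exp (- s) * c)) * indicator {0..} s \<partial>lborel)
      \<le> (\<integral>\<^sup>+s. 2 * indicator {0..L} s + ennreal (exp (- s) * (1 + c)) * indicator {L..} s \<partial>lborel)"
  proof (rule nn_integral_mono)
    fix s :: real
    have "ennreal (min 2 (exp (- s) * c)) \<le> ennreal 2"
      "ennreal (min 2 (exp (- s) * c)) \<le> ennreal (exp (- s) * (1 + c))"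
      by (rule ennreal_leI, simp add: min_le_iff_disj algebra_simps)+
    then show "ennreal (min 2 (exp (- s) * c)) * indicator {0..} s
        \<le> 2 * indicator {0..L} s + ennreal (exp (- s) * (1 + c)) * indicator {L..} s"
      by (auto simp: indicator_def add_increasing)
  qed
  also have "\<dots> = 2 * ennreal L + (\<integral>\<^sup>+s. ennreal (exp (- s) * (1 + c)) * indicator {L..} s \<partial>lborel)"
    using L(1) by (simp add: nn_integral_add nn_integral_cmult)
  also have "(\<integral>\<^sup>+s. ennreal (exp (- s) * (1 + c)) * indicator {L..} s \<partial>lborel)
      = ennreal (0 - (- (exp (- L) * (1 + c))))"
  proof (rule nn_integral_FTC_atLeast)
    show "((\<lambda>s. - (exp (- s) * (1 + c))) has_real_derivative exp (- s) * (1 + c)) (at s)" for s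
      by (auto intro!: derivative_eq_intros)
    have "((\<lambda>s::real. exp (- s)) \<longlongrightarrow> 0) at_top"
      by (rule filterlim_compose[OF exp_at_bot filterlim_uminus_at_bot_at_top])
    from tendsto_minus[OF tendsto_mult_right[OF this, of "1 + c"]]
    show "((\<lambda>s. - (exp (- s) * (1 + c))) \<longlongrightarrow> 0) at_top" by simp
  qed (use c in auto)
  also have "2 * ennreal L + ennreal (0 - (- (exp (- L) * (1 + c)))) = ennreal (2 * L + 1)"
    using L by (simp add: ennreal_plus ennreal_mult)
  finally show ?thesis by (simp add: L_def)
qed

lemma norm_char_functional_minus_1_le:
  assumes \<mu>: "borel_prob \<mu>"
  shows "ennreal (norm (char_functional \<mu> y - 1)) \<le> (\<integral>\<^sup>+x. ennreal (min 2 \<bar>blinfun_apply y x\<bar>) \<partial>\<mu>)"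
proof -
  interpret prob_space \<mu> using \<mu> by (simp add: borel_prob_def)
  have i: "integrable \<mu> (\<lambda>x. iexp (blinfun_apply y x) - 1)"
    by (intro Bochner_Integration.integrable_diff integrable_iexp_blinfun \<mu> integrable_const)
  have "char_functional \<mu> y - 1 = (CLINT x|\<mu>. iexp (blinfun_apply y x) - 1)"
    using integrable_iexp_blinfun[OF \<mu>, of y] by (simp add: char_functional_def prob_space)
  then have "ennreal (norm (char_functional \<mu> y - 1)) \<le> (\<integral>\<^sup>+x. ennreal (norm (iexp (blinfun_apply y x) - 1)) \<partial>\<mu>)"
    using integral_norm_bound_ennreal[OF i] by simp
  also have "\<dots> \<le> (\<integral>\<^sup>+x. ennreal (min 2 \<bar>blinfun_apply y x\<bar>) \<partial>\<mu>)"
  proof (intro nn_integral_mono ennreal_leI min.boundedI)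
    fix x
    show "norm (iexp (blinfun_apply y x) - 1) \<le> \<bar>blinfun_apply y x\<bar>"
      using iexp_approx1[of "blinfun_apply y x" 0] by simp
    show "norm (iexp (blinfun_apply y x) - 1) \<le> 2"
      using norm_triangle_ineq4[of "iexp (blinfun_apply y x)" 1] by simp
  qed
  finally show ?thesis .
qed

text \<open>By Tonelli, integrate over \<open>s\<close> first: the inner integral of \<open>min 2 (e\<^sup>-\<^sup>s \<bar>y x\<bar>)\<close> grows like
  \<open>2 * ln (1 + \<bar>y x\<bar>)\<close>, which the logarithmic moment makes \<open>\<mu>\<close>-integrable.\<close>

lemma char_functional_deviation_integrable:
  assumes \<mu>: "borel_prob \<mu>" and log: "integrable \<mu> (\<lambda>x. ln (1 + norm x))"
  shows "set_integrable lborel {0..} (\<lambda>s. char_functional \<mu> (exp (- s) *\<^sub>R y) - 1)"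
proof -
  interpret prob_space \<mu> using \<mu> by (simp add: borel_prob_def)
  have [measurable_cong]: "sets \<mu> = sets borel" using \<mu> by (simp add: borel_prob_def)
  interpret pair_sigma_finite \<mu> "lborel :: real measure" ..
  have "continuous_on UNIV (\<lambda>s::real. char_functional \<mu> (exp (- s) *\<^sub>R y))"
    by (rule continuous_on_compose2[OF continuous_on_char_functional[OF \<mu>]])
      (auto intro!: continuous_intros)
  then have [measurable]: "(\<lambda>s. char_functional \<mu> (exp (- s) *\<^sub>R y)) \<in> borel_measurable borel"
    by (rule borel_measurable_continuous_onI)
  let ?d = "\<lambda>s x. ennreal (min 2 (exp (- s) * \<bar>blinfun_apply y x\<bar>)) * indicator {0..} s"
  have "(\<integral>\<^sup>+s. ennreal (norm (indicator {0..} s *\<^sub>R (char_functional \<mu> (exp (- s) *\<^sub>R y) - 1))) \<partial>lborel)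
      \<le> (\<integral>\<^sup>+s. (\<integral>\<^sup>+x. ?d s x \<partial>\<mu>) \<partial>lborel)"
  proof (rule nn_integral_mono)
    fix s :: real
    show "ennreal (norm (indicator {0..} s *\<^sub>R (char_functional \<mu> (exp (- s) *\<^sub>R y) - 1)))
        \<le> (\<integral>\<^sup>+x. ?d s x \<partial>\<mu>)"
      using norm_char_functional_minus_1_le[OF \<mu>, of "exp (- s) *\<^sub>R y"]
      by (simp add: indicator_def blinfun.scaleR_left abs_mult)
  qed
  also have "\<dots> = (\<integral>\<^sup>+x. (\<integral>\<^sup>+s. ?d s x \<partial>lborel) \<partial>\<mu>)"
    by (rule Fubini') measurable
  also have "\<dots> \<le> (\<integral>\<^sup>+x. ennreal (2 * ln (1 + norm y) + 1 + 2 * ln (1 + norm x)) \<partial>\<mu>)"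
  proof (rule nn_integral_mono)
    fix x
    have "1 + \<bar>blinfun_apply y x\<bar> \<le> 1 + norm y * norm x"
      using norm_blinfun[of y x] by simp
    also have "\<dots> \<le> (1 + norm y) * (1 + norm x)"
      by (simp add: algebra_simps)
    finally have "ln (1 + \<bar>blinfun_apply y x\<bar>) \<le> ln ((1 + norm y) * (1 + norm x))"
      by (subst ln_le_cancel_iff) (auto intro!: mult_pos_pos add_pos_nonneg)
    also have "\<dots> = ln (1 + norm y) + ln (1 + norm x)"
      by (rule ln_mult_pos) (auto intro!: add_pos_nonneg)
    finally have "ennreal (2 * ln (1 + \<bar>blinfun_apply y x\<bar>) + 1)
        \<le> ennreal (2 * ln (1 + norm y) + 1 + 2 * ln (1 + norm x))"
      by (intro ennreal_leI) simp
    then show "(\<integral>\<^sup>+s. ?d s x \<partial>lborel) \<le> ennreal (2 * ln (1 + norm y) + 1 + 2 * ln (1 + norm x))"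
      using nn_integral_truncated_exp_le[of "\<bar>blinfun_apply y x\<bar>"] by (meson abs_ge_zero order_trans)
  qed
  also have "\<dots> < \<infinity>"
  proof -
    have "integrable \<mu> (\<lambda>x. 2 * ln (1 + norm y) + 1 + 2 * ln (1 + norm x))"
      by (intro Bochner_Integration.integrable_add integrable_mult_right log integrable_const)
    then show ?thesis
      by (subst nn_integral_eq_integral) auto
  qed
  finally show ?thesis
    unfolding set_integrable_def by (intro integrableI_bounded) auto
qed

text \<open>Since \<open>exp\<close> has derivative \<open>1\<close> at \<open>0\<close>, a small logarithm is controlled by the deviation of its
  exponential from \<open>1\<close>.\<close>

lemma norm_le_exp_minus_1:
  "\<exists>\<delta>>0. \<forall>z::complex. norm z < \<delta> \<longrightarrow> norm z \<le> 2 * norm (exp z - 1)"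
proof -
  have "((\<lambda>z::complex. (exp z - exp 0) / (z - 0)) \<longlongrightarrow> exp 0) (at 0)"
    using DERIV_exp[of "0::complex"] unfolding has_field_derivative_iff by simp
  then have "((\<lambda>z::complex. norm ((exp z - 1) / z)) \<longlongrightarrow> 1) (at 0)"
    using tendsto_norm by fastforce
  then have "eventually (\<lambda>z::complex. 1 / 2 < norm ((exp z - 1) / z)) (at 0)"
    by (rule order_tendstoD) simp
  then obtain \<delta> where \<delta>: "\<delta> > 0" "\<And>z::complex. z \<noteq> 0 \<Longrightarrow> norm z < \<delta> \<Longrightarrow> 1 / 2 < norm ((exp z - 1) / z)"
    by (auto simp: eventually_at)
  have "norm z \<le> 2 * norm (exp z - 1)" if "norm z < \<delta>" for z :: complex
    using \<delta>(2)[of z] that by (cases "z = 0") (auto simp: norm_divide field_simps)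
  with \<delta>(1) show ?thesis by blast
qed

text \<open>For large \<open>s\<close> the logarithm is small, hence at most twice the deviation of the characteristic
  functional from \<open>1\<close>; on a compact interval it is bounded.\<close>

lemma ray_logarithm_integrable:
  assumes \<mu>: "borel_prob \<mu>" and log: "integrable \<mu> (\<lambda>x. ln (1 + norm x))"
    and \<Phi>: "ray_logarithm \<mu> \<Phi>"
  shows "set_integrable lborel {0..} (\<lambda>s. \<Phi> (exp (- s) *\<^sub>R y))"
proof -
  let ?H = "\<lambda>s::real. \<Phi> (exp (- s) *\<^sub>R y)"
  have ray: "continuous_on UNIV (\<lambda>t. \<Phi> (t *\<^sub>R y))" and [simp]: "\<Phi> 0 = 0"
    using \<Phi> by (auto simp: ray_logarithm_def)
  have cont: "continuous_on UNIV ?H"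
    by (rule continuous_on_compose2[OF ray]) (auto intro!: continuous_intros)
  have exp0: "((\<lambda>s::real. exp (- s)) \<longlongrightarrow> 0) at_top"
    by (rule filterlim_compose[OF exp_at_bot filterlim_uminus_at_bot_at_top])
  have lim: "(?H \<longlongrightarrow> 0) at_top"
    using continuous_on_tendsto_compose[OF ray exp0] by simp
  obtain \<delta> where \<delta>: "\<delta> > 0" "\<And>z::complex. norm z < \<delta> \<Longrightarrow> norm z \<le> 2 * norm (exp z - 1)"
    using norm_le_exp_minus_1 by blast
  have "eventually (\<lambda>s. norm (?H s) < \<delta>) at_top"
    using tendstoD[OF lim \<delta>(1)] by simp
  then obtain N0 where N0: "\<And>s. s \<ge> N0 \<Longrightarrow> norm (?H s) < \<delta>"
    by (auto simp: eventually_at_top_linorder)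
  define N where "N = max 0 N0"
  have tail: "set_integrable lborel {N..} ?H"
  proof (rule set_integrable_bound)
    have "set_integrable lborel {0..} (\<lambda>s. 2 * (char_functional \<mu> (exp (- s) *\<^sub>R y) - 1))"
      by (intro set_integrable_mult_right char_functional_deviation_integrable \<mu> log)
    then show "set_integrable lborel {N..} (\<lambda>s. 2 * (char_functional \<mu> (exp (- s) *\<^sub>R y) - 1))"
      by (rule set_integrable_subset) (auto simp: N_def)
    have [measurable]: "?H \<in> borel_measurable borel"
      using cont by (rule borel_measurable_continuous_onI)
    show "set_borel_measurable lborel {N..} ?H"
      unfolding set_borel_measurable_def by measurable
    show "AE s in lborel. s \<in> {N..} \<longrightarrow> norm (?H s) \<le> norm (2 * (char_functional \<mu> (exp (- s) *\<^sub>R y) - 1))"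
    proof (intro AE_I2 impI)
      fix s assume "s \<in> {N..}"
      then have "norm (?H s) \<le> 2 * norm (exp (?H s) - 1)"
        by (intro \<delta>(2) N0) (simp add: N_def)
      then show "norm (?H s) \<le> norm (2 * (char_functional \<mu> (exp (- s) *\<^sub>R y) - 1))"
        using \<Phi> by (simp only: ray_logarithm_def norm_mult norm_numeral)
    qed
  qed
  have "set_integrable lborel {0..N} ?H"
    by (rule borel_integrable_atLeastAtMost') (rule continuous_on_subset[OF cont], simp)
  then have "set_integrable lborel ({0..N} \<union> {N..}) ?H"
    by (rule set_integrable_Un) (auto intro: tail)
  then show ?thesis
    by (rule set_integrable_subset) auto
qed

section \<open>Equivalence of the two conditions\<close>

theorem corollary1:
  fixes \<nu> \<rho> :: "'a::{banach, second_countable_topology} measure"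
  assumes "\<nu> \<in> ID_log" and "\<rho> \<in> ID_log"
  shows "(\<forall>y :: 'a \<Rightarrow>\<^sub>L real.
            exp (CLBINT s:{0..}. levy_exponent \<nu> (exp (- s) *\<^sub>R y)) * char_functional \<nu> y
              = exp (CLBINT s:{0..}. levy_exponent \<rho> (exp (- s) *\<^sub>R y)))
     \<longleftrightarrow> (\<forall>y :: 'a \<Rightarrow>\<^sub>L real.
            char_functional \<nu> y = exp (CLBINT s:{0..1}. levy_exponent \<rho> (s *\<^sub>R y)))"
    (is "(\<forall>y. ?A y) \<longleftrightarrow> (\<forall>y. ?B y)")
proof -
  have \<nu>: "ray_logarithm \<nu> (levy_exponent \<nu>)" and \<rho>: "ray_logarithm \<rho> (levy_exponent \<rho>)"
    using assms by (auto simp: ID_log_def intro: ray_logarithm_levy_exponent)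
  have int: "set_integrable lborel {0..} (\<lambda>s. levy_exponent \<nu> (exp (- s) *\<^sub>R y))"
    "set_integrable lborel {0..} (\<lambda>s. levy_exponent \<rho> (exp (- s) *\<^sub>R y))" for y
    using assms
    by (auto intro!: ray_logarithm_integrable[OF _ _ \<nu>] ray_logarithm_integrable[OF _ _ \<rho>] simp: ID_log_def ID_def)
  have ray: "(\<forall>t>0. ?A (t *\<^sub>R y)) \<longleftrightarrow> (\<forall>t>0. ?B (t *\<^sub>R y))" for y
    using ray_equation_iff[of "\<lambda>t. levy_exponent \<nu> (t *\<^sub>R y)" "\<lambda>t. levy_exponent \<rho> (t *\<^sub>R y)"] int \<nu> \<rho>
    by (simp add: ray_logarithm_def)
  show ?thesis
  proof
    assume "\<forall>y. ?A y"
    then have "\<forall>t>0. ?B (t *\<^sub>R y)" for y using ray[of y] by blast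
    from this[rule_format, of 1] show "\<forall>y. ?B y" by simp
  next
    assume "\<forall>y. ?B y"
    then have "\<forall>t>0. ?A (t *\<^sub>R y)" for y using ray[of y] by blast
    from this[rule_format, of 1] show "\<forall>y. ?A y" by simp
  qed
qed

end
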